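(* Let $\ell \in \{2,3,\dots\}$. (i) For every $q \in \mathbb{C}$ with $|q|<1$ and every $z \in \mathbb{C}$, $$ z(1-q)\sum_{k=0}^{\infty} q^{k}\, (q^{k+1}z;q)_{\ell-1} \;=\; \frac{(1-q)\bigl(1-(z;q)_{\ell}\bigr)}{1-q^{\ell}}\, . $$ (ii) We have $$ \lim_{N\to\infty} \frac{1}{N}\sum_{n=1}^{N} \frac{B(\ell,n)}{n^{\ell-1}} \;=\; \zeta(2)\zeta(3)\cdots\zeta(\ell)\, , $$ where $\zeta$ is the Riemann zeta function.
   Context: For $r \in \{0,1,2,\dots\}$, the $q$-Pochhammer symbol is $(z;q)_r=(1-z)(1-qz)(1-q^2z)\cdots(1-q^{r-1}z)$, with $(z;q)_0=1$. Let $S_n$ be the symmetric group on $[n]=\{1,\dots,n\}$. For $\ell,n \in \mathbb{N}$, call an $\ell$-tuple $(\pi_1,\dots,\pi_\ell)\in S_n^{\ell}$ commuting if $\pi_i\pi_j=\pi_j\pi_i$ for all $1\le i<j\le \ell$. Let $A(\ell,n,1)$ be the number of commuting $\ell$-tuples for which the subgroup $\langle \pi_1,\dots,\pi_\ell\rangle$ acts transitively on $[n]$ (i.e. has exactly one orbit). Define $B(\ell,n)=A(\ell,n,1)/(n-1)!$. It is known that $$ B(\ell,n)=\sum_{\substack{(f_1,\dots,f_\ell)\in\mathbb{N}^\ell\\ f_1 f_2\cdots f_\ell=n}} f_1^{\ell-1}f_2^{\ell-2}\cdots f_{\ell-1} $$ (for $\ell=2$ this is the sum-of-divisors function $\sigma_1(n)$,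 so $B(2,n)/n$ is the abundancy index). *)

theory Defs
  imports
    Complex_Main
    "HOL-Algebra.Group_Action"
    "HOL-Algebra.Generated_Groups"
    "HOL-Algebra.Sym_Groups"
begin

definition q_pochhammer :: "complex \<Rightarrow> complex \<Rightarrow> nat \<Rightarrow> complex" where
  "q_pochhammer z q r = (\<Prod>i<r. 1 - q ^ i * z)"

text \<open>The Riemann zeta function on the half-line \<open>s > 1\<close>, where it is given by its
  (convergent) Dirichlet series. No continuation is made: for \<open>s \<le> 1\<close> the value is meaningless.\<close>

definition zeta :: "real \<Rightarrow> real" where
  "zeta s = (\<Sum>n. 1 / real (Suc n) powr s)"

definition commuting_tuples :: "nat \<Rightarrow> nat \<Rightarrow> (nat \<Rightarrow> nat) list set" where
  "commuting_tuples l n =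
     {ps. length ps = l \<and> set ps \<subseteq> carrier (sym_group n) \<and>
          (\<forall>i j. i < j \<and> j < l \<longrightarrow> ps ! i \<otimes>\<^bsub>sym_group n\<^esub> ps ! j = ps ! j \<otimes>\<^bsub>sym_group n\<^esub> ps ! i)}"

definition subgroup_orbits :: "nat \<Rightarrow> (nat \<Rightarrow> nat) set \<Rightarrow> nat set set" where
  "subgroup_orbits n H =
     orbits ((sym_group n)\<lparr>carrier := generate (sym_group n) H\<rparr>) {1..n} (\<lambda>p x. p x)"

definition A_comm :: "nat \<Rightarrow> nat \<Rightarrow> nat \<Rightarrow> nat" where
  "A_comm l n k = card {ps \<in> commuting_tuples l n. card (subgroup_orbits n (set ps)) = k}"

definition B_comm :: "nat \<Rightarrow> nat \<Rightarrow> real" where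
  "B_comm l n = real (A_comm l n 1) / fact (n - 1)"

end

theory Submission
  imports
    Defs
    "HOL-Analysis.Summation_Tests"
    "HOL-Analysis.Uniform_Limit"
begin

text \<open>
  Part (i) telescopes: \<open>q\<^sup>k z (q\<^sup>k\<^sup>+\<^sup>1 z; q)\<close> at length \<open>l - 1\<close>, times \<open>1 - q\<^sup>l\<close>, is the
  difference of \<open>(q\<^sup>k\<^sup>+\<^sup>1 z; q)\<close> and \<open>(q\<^sup>k z; q)\<close> at length \<open>l\<close>.

  For part (ii), let \<open>p, p\<^sub>1, \<dots>, p\<^sub>l\<close> be a transitive commuting tuple on \<open>X\<close> with \<open>|X| = n\<close>, and
  let \<open>Q\<close> be the orbit of a base point under \<open>p\<^sub>1, \<dots>, p\<^sub>l\<close>. With \<open>m = |Q|\<close>, \<open>p\<close> permutes the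
  \<open>d = n / m\<close> orbits cyclically, so the tuple amounts to: the set \<open>Q\<close>, the restrictions of the \<open>p\<^sub>i\<close>
  to \<open>Q\<close>, the return map \<open>p\<^sup>d\<close> on \<open>Q\<close> (an element of the centralizer, which has \<open>m\<close> elements),
  and the bijections \<open>p\<^sup>i\<close> from \<open>Q\<close> to the other orbits (\<open>(n - m)!\<close> choices). Counting gives
  \<open>B(l + 1, n) = \<Sum>\<^sub>m\<^sub>|\<^sub>n m B(l, m)\<close>, that is, \<open>B(l + 1, n) / n\<^sup>l\<close> is the Dirichlet convolution of
  \<open>B(l, n) / n\<^sup>l\<^sup>-\<^sup>1\<close> with \<open>d\<^sup>-\<^sup>l\<close>. By dominated convergence such a convolution multiplies mean values
  by \<open>\<Sum>\<^sub>d d\<^sup>-\<^sup>l / d = \<zeta>(l + 1)\<close>.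
\<close>

section \<open>Transitive commuting tuples\<close>

text \<open>For permutations of a finite set, an invariant subset is also invariant under inverses, so no
  generated group is needed here.\<close>

definition transitive_on :: "('a \<Rightarrow> 'a) set \<Rightarrow> 'a set \<Rightarrow> bool" where
  "transitive_on P X \<longleftrightarrow> (\<forall>Z \<subseteq> X. Z \<noteq> {} \<longrightarrow> (\<forall>p\<in>P. p ` Z \<subseteq> Z) \<longrightarrow> Z = X)"

definition commute :: "('a \<Rightarrow> 'a) \<Rightarrow> ('a \<Rightarrow> 'a) \<Rightarrow> bool" where
  "commute p q \<longleftrightarrow> p \<circ> q = q \<circ> p"

definition transitive_tuples :: "nat \<Rightarrow> 'a set \<Rightarrow> ('a \<Rightarrow> 'a) list set" where
  "transitive_tuples l X = {ps. length ps = l \<and> (\<forall>p\<in>set ps. p permutes X) \<and>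
     (\<forall>p\<in>set ps. \<forall>q\<in>set ps. commute p q) \<and> transitive_on (set ps) X}"

definition centralizer :: "('a \<Rightarrow> 'a) set \<Rightarrow> 'a set \<Rightarrow> ('a \<Rightarrow> 'a) set" where
  "centralizer P X = {c. c permutes X \<and> (\<forall>p\<in>P. commute p c)}"

lemma commute_sym: "commute p q \<longleftrightarrow> commute q p"
  unfolding commute_def by metis

lemma commute_refl: "commute p p"
  by (simp add: commute_def)

lemma commuteD: "commute p q \<Longrightarrow> p (q x) = q (p x)"
  by (metis commute_def comp_apply)

lemma commuteI: "(\<And>x. p (q x) = q (p x)) \<Longrightarrow> commute p q"
  by (simp add: commute_def fun_eq_iff)

lemma transitive_onD:
  "transitive_on P X \<Longrightarrow> Z \<subseteq> X \<Longrightarrow> z \<in> Z \<Longrightarrow> (\<And>p x. p \<in> P \<Longrightarrow> x \<in> Z \<Longrightarrow> p x \<in> Z) \<Longrightarrow> Z = X"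
  unfolding transitive_on_def by blast

lemma generate_invariant:
  assumes P: "P \<subseteq> carrier (sym_group n)" and Z: "Z \<subseteq> {1..n}" "\<forall>p\<in>P. p ` Z \<subseteq> Z"
    and g: "g \<in> generate (sym_group n) P"
  shows "g ` Z \<subseteq> Z"
  using g
proof induction
  case one
  then show ?case by (simp add: sym_group_one)
next
  case (incl h)
  then show ?case using Z by blast
next
  case (inv h)
  have h: "h permutes {1..n}" using P inv by (auto simp: sym_group_carrier)
  have fin: "finite Z" using Z(1) finite_subset by blast
  \<comment> \<open>An injective map of the finite set Z into itself is onto, so the inverse of h
    preserves Z as well.\<close>
  have "h ` Z = Z"
    using Z(2) inv by (intro endo_inj_surj[OF fin _ permutes_inj_on[OF h]]) blast
  then have "inv' h ` Z = Z" using permutes_inj[OF h] by (metis image_inv_f_f)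
  moreover have "inv\<^bsub>sym_group n\<^esub> h = inv' h" using P inv by auto
  ultimately show ?case by simp
next
  case (eng h1 h2)
  then show ?case by (auto simp: sym_group_mult)
qed

text \<open>A P-invariant set is invariant under the generated group, so it contains the orbit of
  each of its points; conversely, every orbit is itself P-invariant. The case n = 0 is excluded
  because there are then no orbits at all, while \<open>transitive_on\<close> holds vacuously on the
  empty set.\<close>

lemma subgroup_orbits_eq_1_iff:
  assumes P: "P \<subseteq> carrier (sym_group n)" and n: "n \<ge> 1"
  shows "card (subgroup_orbits n P) = 1 \<longleftrightarrow> transitive_on P {1..n}"
proof -
  define orb where "orb x = {g x |g. g \<in> generate (sym_group n) P}" for x
  have eq: "subgroup_orbits n P = orb ` {1..n}"
    by (auto simp: subgroup_orbits_def orbits_def orbit_def orb_def)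
  interpret group "sym_group n" by (rule sym_group_is_group)
  have sub: "orb x \<subseteq> {1..n}" if "x \<in> {1..n}" for x
  proof
    fix y assume "y \<in> orb x"
    then obtain g where g: "g \<in> generate (sym_group n) P" "y = g x" by (auto simp: orb_def)
    then have "g permutes {1..n}"
      using generate_in_carrier[OF P] by (auto simp: sym_group_carrier)
    then show "y \<in> {1..n}" using g that by (metis permutes_in_image)
  qed
  have refl: "x \<in> orb x" for x
  proof -
    have "id \<in> generate (sym_group n) P"
      using generate.one[of "sym_group n" P] by (simp add: sym_group_one)
    then show ?thesis unfolding orb_def by (intro CollectI exI[of _ id]) simp
  qed
  have step: "p y \<in> orb x" if "y \<in> orb x" "p \<in> P" for p x y
  proof -
    obtain g where g: "g \<in> generate (sym_group n) P" "y = g x" using \<open>y \<in> orb x\<close> by (auto simp: orb_def)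
    have "p \<circ> g \<in> generate (sym_group n) P"
      using generate.eng[OF generate.incl[OF \<open>p \<in> P\<close>] g(1)] by (simp add: sym_group_mult)
    then show ?thesis using g unfolding orb_def by (intro CollectI exI[of _ "p \<circ> g"]) simp
  qed
  show ?thesis
  proof
    assume "card (subgroup_orbits n P) = 1"
    then obtain S where S: "orb ` {1..n} = {S}" unfolding eq by (auto simp: card_1_singleton_iff)
    show "transitive_on P {1..n}"
      unfolding transitive_on_def
    proof (intro allI impI)
      fix Z assume Z: "Z \<subseteq> {1..n}" "Z \<noteq> {}" "\<forall>p\<in>P. p ` Z \<subseteq> Z"
      then obtain z where z: "z \<in> Z" by blast
      have "orb z \<subseteq> Z"
      proof
        fix y assume "y \<in> orb z"
        then obtain g where g: "g \<in> generate (sym_group n) P" "y = g z" by (auto simp: orb_def)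
        have "g ` Z \<subseteq> Z" by (rule generate_invariant[OF P Z(1) Z(3) g(1)])
        then show "y \<in> Z" using z g(2) by blast
      qed
      moreover have "{1..n} \<subseteq> orb z"
      proof
        fix y assume "y \<in> {1..n}"
        moreover have "z \<in> {1..n}" using z Z(1) by (rule rev_subsetD)
        ultimately have "orb y \<in> {S}" "orb z \<in> {S}" unfolding S[symmetric] by (simp_all only: imageI)
        then show "y \<in> orb z" using refl[of y] by simp
      qed
      ultimately show "Z = {1..n}" using Z(1) by simp
    qed
  next
    assume tr: "transitive_on P {1..n}"
    have "orb x = {1..n}" if "x \<in> {1..n}" for x
      by (rule transitive_onD[OF tr sub[OF that] refl]) (rule step)
    then have "orb ` {1..n} = {{1..n}}" using n by auto
    then show "card (subgroup_orbits n P) = 1" by (simp add: eq)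
  qed
qed

lemma A_comm_eq_card:
  assumes "n \<ge> 1"
  shows "A_comm l n 1 = card (transitive_tuples l {1..n})"
proof -
  have "{ps \<in> commuting_tuples l n. card (subgroup_orbits n (set ps)) = 1} = transitive_tuples l {1..n}"
  proof (intro Set.set_eqI iffI)
    fix ps assume "ps \<in> {ps \<in> commuting_tuples l n. card (subgroup_orbits n (set ps)) = 1}"
    then have ps: "length ps = l" "set ps \<subseteq> carrier (sym_group n)"
       "\<And>i j. i < j \<Longrightarrow> j < l \<Longrightarrow> ps ! i \<circ> ps ! j = ps ! j \<circ> ps ! i"
       "card (subgroup_orbits n (set ps)) = 1"
      by (auto simp: commuting_tuples_def sym_group_mult)
    \<comment> \<open>\<open>commuting_tuples\<close> speaks of i < j only; symmetry and reflexivity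
      supply the remaining pairs.\<close>
    have "commute (ps ! i) (ps ! j)" if "i < l" "j < l" for i j
      using ps(3)[of i j] ps(3)[of j i] that commute_refl commute_sym
      by (metis commute_def nat_neq_iff)
    then have "commute p q" if "p \<in> set ps" "q \<in> set ps" for p q
      using that ps(1) by (metis in_set_conv_nth)
    then show "ps \<in> transitive_tuples l {1..n}"
      using ps(1,2,4) subgroup_orbits_eq_1_iff[OF ps(2) assms]
      by (auto simp: transitive_tuples_def sym_group_carrier)
  next
    fix ps assume ps: "ps \<in> transitive_tuples l {1..n}"
    then have P: "set ps \<subseteq> carrier (sym_group n)" and len: "length ps = l"
      by (auto simp: transitive_tuples_def sym_group_carrier)
    have "commute (ps ! i) (ps ! j)" if "i < j" "j < l" for i j
      using ps that by (simp add: transitive_tuples_def)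
    then have "ps \<in> commuting_tuples l n"
      using P len unfolding commuting_tuples_def sym_group_mult commute_def by blast
    then show "ps \<in> {ps \<in> commuting_tuples l n. card (subgroup_orbits n (set ps)) = 1}"
      using subgroup_orbits_eq_1_iff[OF P assms] ps by (simp add: transitive_tuples_def)
  qed
  then show ?thesis by (simp add: A_comm_def)
qed

lemma card_centralizer:
  assumes P: "\<And>p. p \<in> P \<Longrightarrow> p permutes X" "\<And>p q. p \<in> P \<Longrightarrow> q \<in> P \<Longrightarrow> commute p q"
    and tr: "transitive_on P X" and x0: "x0 \<in> X"
  shows "card (centralizer P X) = card X"
proof -
  \<comment> \<open>Evaluation at \<open>x0\<close> is injective since the set where two elements agree is invariant, and
      surjective since its image is.\<close>
  have "bij_betw (\<lambda>c. c x0) (centralizer P X) X"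
  proof (rule bij_betwI')
    fix c c' assume c: "c \<in> centralizer P X" "c' \<in> centralizer P X"
    show "c x0 = c' x0 \<longleftrightarrow> c = c'"
    proof
      assume eq: "c x0 = c' x0"
      have "{x \<in> X. c x = c' x} = X"
      proof (rule transitive_onD[OF tr, of _ x0])
        fix p x assume p: "p \<in> P" and "x \<in> {x \<in> X. c x = c' x}"
        moreover from this have "p x \<in> X" using permutes_in_image[OF P(1)] by auto
        moreover have "c (p x) = p (c x)" "c' (p x) = p (c' x)"
          using c p by (auto simp: centralizer_def commuteD)
        ultimately show "p x \<in> {x \<in> X. c x = c' x}" by simp
      qed (use eq x0 in auto)
      then have "c x = c' x" for x
        using c by (cases "x \<in> X") (auto simp: centralizer_def permutes_not_in)
      then show "c = c'" ..
    qed auto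
  next
    fix c assume "c \<in> centralizer P X" then show "c x0 \<in> X"
      using x0 by (auto simp: centralizer_def permutes_in_image)
  next
    fix y assume y: "y \<in> X"
    have "(\<lambda>c. c x0) ` centralizer P X = X"
    proof (rule transitive_onD[OF tr, of _ x0])
      have "id \<in> centralizer P X" by (auto simp: centralizer_def permutes_id commute_def)
      then show "x0 \<in> (\<lambda>c. c x0) ` centralizer P X" by (rule rev_image_eqI) simp
    next
      fix p x assume p: "p \<in> P" and "x \<in> (\<lambda>c. c x0) ` centralizer P X"
      then obtain c where c: "c \<in> centralizer P X" "x = c x0" by blast
      have "commute q (p \<circ> c)" if "q \<in> P" for q
      proof (rule commuteI)
        fix x
        show "q ((p \<circ> c) x) = (p \<circ> c) (q x)"
          using commuteD[OF P(2)[OF p that], of "c x"] commuteD[of q c x] c(1) that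
          by (simp add: centralizer_def)
      qed
      then have "p \<circ> c \<in> centralizer P X"
        using P(1)[OF p] c(1) by (auto simp: centralizer_def intro: permutes_compose)
      then show "p x \<in> (\<lambda>c. c x0) ` centralizer P X" by (rule rev_image_eqI) (simp add: c(2))
    qed (use x0 in \<open>auto simp: centralizer_def permutes_in_image\<close>)
    then show "\<exists>c\<in>centralizer P X. y = c x0" using y by auto
  qed
  then show ?thesis by (rule bij_betw_same_card)
qed

section \<open>Orbits of the tail of a tuple\<close>

text \<open>Closed under forward application only. For permutations of a finite set this still gives
  the orbits of the generated group, and \<open>orb_eq\<close> shows that they partition the
  set.\<close>

inductive_set orb :: "('a \<Rightarrow> 'a) set \<Rightarrow> 'a \<Rightarrow> 'a set" for P x where
  base: "x \<in> orb P x"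
| step: "y \<in> orb P x \<Longrightarrow> p \<in> P \<Longrightarrow> p y \<in> orb P x"

lemma orb_subset:
  assumes "\<And>p z. p \<in> P \<Longrightarrow> z \<in> Z \<Longrightarrow> p z \<in> Z" "x \<in> Z"
  shows "orb P x \<subseteq> Z"
proof
  fix y assume "y \<in> orb P x"
  then show "y \<in> Z" by induction (use assms in auto)
qed

text \<open>By finiteness each p in P maps \<open>orb P y\<close> onto itself, so by injectivity it
  also maps the complement in X into itself. Starting from x in that complement, y could never be
  reached.\<close>

lemma orb_eq:
  assumes P: "\<And>p. p \<in> P \<Longrightarrow> p permutes X" and X: "finite X" "x \<in> X" and y: "y \<in> orb P x"
  shows "orb P y = orb P x"
proof -
  have PX: "p z \<in> X \<longleftrightarrow> z \<in> X" if "p \<in> P" for p z using permutes_in_image[OF P[OF that]] .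
  have subX: "orb P z \<subseteq> X" if "z \<in> X" for z using PX that by (intro orb_subset) auto
  have yX: "y \<in> X" using subX[OF X(2)] y by blast
  have "x \<in> orb P y"
  proof (rule ccontr)
    assume x: "x \<notin> orb P y"
    have "orb P x \<subseteq> X - orb P y"
    proof (rule orb_subset)
      fix p z assume p: "p \<in> P" and z: "z \<in> X - orb P y"
      have "finite (orb P y)" using subX[OF yX] X(1) finite_subset by blast
      then have "p ` orb P y = orb P y"
        using p by (intro endo_inj_surj permutes_inj_on[OF P]) (auto intro: orb.step)
      moreover have "p z \<notin> p ` orb P y" using z permutes_inj[OF P[OF p]] by (auto dest: injD)
      ultimately show "p z \<in> X - orb P y" using z PX[OF p] by auto
    qed (use x X in auto)
    then show False using y orb.base[of y P] by blast
  qed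
  then show ?thesis
    using y by (intro equalityI orb_subset) (auto intro: orb.step)
qed

lemma orb_transitive:
  assumes "\<And>p. p \<in> P \<Longrightarrow> p permutes X" "finite X" "x \<in> X"
  shows "transitive_on P (orb P x)"
  unfolding transitive_on_def
proof (intro allI impI)
  fix Z assume Z: "Z \<subseteq> orb P x" "Z \<noteq> {}" "\<forall>p\<in>P. p ` Z \<subseteq> Z"
  then obtain z where "z \<in> Z" by blast
  then have "orb P z \<subseteq> Z" using Z(3) by (intro orb_subset) auto
  moreover have "orb P z = orb P x" using Z(1) \<open>z \<in> Z\<close> by (intro orb_eq[OF assms]) auto
  ultimately show "Z = orb P x" using Z(1) by auto
qed

text \<open>This is what makes the head of a commuting tuple, and each of its powers, permute the
  orbits of the tail.\<close>

lemma orb_commute_image: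
  assumes "\<And>q. q \<in> P \<Longrightarrow> commute p q"
  shows "p ` orb P x = orb P (p x)"
proof
  have "p y \<in> orb P (p x)" if "y \<in> orb P x" for y
    using that by induction (auto simp: commuteD[OF assms] intro: orb.intros)
  then show "p ` orb P x \<subseteq> orb P (p x)" by blast
  show "orb P (p x) \<subseteq> p ` orb P x"
  proof (rule orb_subset)
    fix q z assume q: "q \<in> P" and "z \<in> p ` orb P x"
    then obtain y where y: "y \<in> orb P x" "z = p y" by blast
    have "q z = p (q y)" using y commuteD[OF assms[OF q]] by simp
    then show "q z \<in> p ` orb P x" using orb.step[OF y(1) q] by (rule image_eqI)
  qed (simp add: orb.base)
qed

lemma commute_funpow: "commute p q \<Longrightarrow> commute (p ^^ k) q"
  by (induction k) (auto simp: commute_def fun_eq_iff)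

section \<open>Transport of self-maps along a bijection, and the layered model\<close>

definition transport :: "('b \<Rightarrow> 'a) \<Rightarrow> 'b set \<Rightarrow> 'a set \<Rightarrow> ('b \<Rightarrow> 'b) \<Rightarrow> 'a \<Rightarrow> 'a" where
  "transport \<beta> Y X g x = (if x \<in> X then \<beta> (g (the_inv_into Y \<beta> x)) else x)"

lemma transport_apply:
  assumes "bij_betw \<beta> Y X" "y \<in> Y"
  shows "transport \<beta> Y X g (\<beta> y) = \<beta> (g y)"
  using assms by (auto simp: transport_def bij_betw_def the_inv_into_f_f)

lemma transport_not_in: "x \<notin> X \<Longrightarrow> transport \<beta> Y X g x = x"
  by (simp add: transport_def)

lemma transport_permutes:
  assumes "bij_betw \<beta> Y X" "bij_betw g Y Y"
  shows "transport \<beta> Y X g permutes X"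
proof (rule bij_imp_permutes)
  have "bij_betw (\<beta> \<circ> g \<circ> the_inv_into Y \<beta>) X X"
    using assms by (intro bij_betw_trans[OF bij_betw_the_inv_into]) (auto intro: bij_betw_trans)
  then show "bij_betw (transport \<beta> Y X g) X X"
    by (rule bij_betw_cong[THEN iffD1, rotated]) (simp add: transport_def)
qed (simp add: transport_not_in)

lemma transport_commute:
  assumes \<beta>: "bij_betw \<beta> Y X"
    and "\<And>y. y \<in> Y \<Longrightarrow> g y \<in> Y" "\<And>y. y \<in> Y \<Longrightarrow> h y \<in> Y" "\<And>y. y \<in> Y \<Longrightarrow> g (h y) = h (g y)"
  shows "commute (transport \<beta> Y X g) (transport \<beta> Y X h)"
proof (rule commuteI)
  fix x
  show "transport \<beta> Y X g (transport \<beta> Y X h x) = transport \<beta> Y X h (transport \<beta> Y X g x)"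
  proof (cases "x \<in> X")
    case True
    then obtain y where "y \<in> Y" "x = \<beta> y" using \<beta> by (auto simp: bij_betw_def)
    then show ?thesis using assms by (simp add: transport_apply[OF \<beta>])
  qed (simp add: transport_not_in)
qed

text \<open>Off X both maps are the identity, so it suffices to compare them on the image of
  \<beta>, which is X.\<close>

lemma transport_eqI:
  assumes \<beta>: "bij_betw \<beta> Y X" and p: "p permutes X" "\<And>y. y \<in> Y \<Longrightarrow> p (\<beta> y) = \<beta> (g y)"
  shows "transport \<beta> Y X g = p"
proof
  fix x show "transport \<beta> Y X g x = p x"
  proof (cases "x \<in> X")
    case True
    then obtain y where "y \<in> Y" "x = \<beta> y" using \<beta> by (auto simp: bij_betw_def)
    then show ?thesis using p by (simp add: transport_apply[OF \<beta>])
  qed (simp add: transport_not_in permutes_not_in[OF p(1)])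
qed

text \<open>Model of the head of a tuple on d stacked copies of Q: climb one layer, and apply the
  return map c when wrapping from layer d - 1 to layer 0. For points in layers below d, its d-th
  power applies c within the layer.\<close>

definition cyc :: "('a \<Rightarrow> 'a) \<Rightarrow> nat \<Rightarrow> 'a \<times> nat \<Rightarrow> 'a \<times> nat" where
  "cyc c d = (\<lambda>(x, i). if Suc i < d then (x, Suc i) else (c x, 0))"

text \<open>Filled up with the identity, not with \<open>undefined\<close> as in
  \<open>restrict\<close>, so that the result can satisfy \<open>permutes\<close> on Q.\<close>

definition restr :: "'a set \<Rightarrow> ('a \<Rightarrow> 'a) \<Rightarrow> 'a \<Rightarrow> 'a" where
  "restr Q p x = (if x \<in> Q then p x else x)"

text \<open>One \<beta> packs the bijections from Q to all d orbits; layer 0 is pinned to Q itself.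
  Extensionality makes \<beta> determined by its values on the layers, so that the set is finite and
  can be counted.\<close>

definition blocks :: "'a set \<Rightarrow> 'a set \<Rightarrow> nat \<Rightarrow> ('a \<times> nat \<Rightarrow> 'a) set" where
  "blocks Q X d = {\<beta> \<in> (Q \<times> {..<d}) \<rightarrow>\<^sub>E X. bij_betw \<beta> (Q \<times> {..<d}) X \<and> (\<forall>x\<in>Q. \<beta> (x, 0) = x)}"

text \<open>The point \<open>\<beta> (x, i)\<close> stands for \<open>p\<^sup>i x\<close>, where \<open>p\<close> is the head of the tuple.\<close>

definition induced_tuple ::
    "'a set \<Rightarrow> 'a set \<Rightarrow> nat \<Rightarrow> ('a \<Rightarrow> 'a) list \<Rightarrow> ('a \<Rightarrow> 'a) \<Rightarrow> ('a \<times> nat \<Rightarrow> 'a) \<Rightarrow> ('a \<Rightarrow> 'a) list" where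
  "induced_tuple X Q d qs c \<beta> = transport \<beta> (Q \<times> {..<d}) X (cyc c d) #
     map (\<lambda>q. transport \<beta> (Q \<times> {..<d}) X (map_prod q id)) qs"

lemma bij_betw_cyc:
  assumes "finite Q" "c permutes Q"
  shows "bij_betw (cyc c d) (Q \<times> {..<d}) (Q \<times> {..<d})"
proof -
  have inj: "inj_on (cyc c d) (Q \<times> {..<d})"
  proof (rule inj_onI)
    fix y z assume yz: "y \<in> Q \<times> {..<d}" "z \<in> Q \<times> {..<d}" "cyc c d y = cyc c d z"
    obtain x i x' i' where "y = (x, i)" "z = (x', i')" by (cases y, cases z) blast
    then show "y = z"
      using yz by (simp add: cyc_def inj_eq[OF permutes_inj[OF assms(2)]] split: if_splits)
  qed
  have "cyc c d ` (Q \<times> {..<d}) \<subseteq> Q \<times> {..<d}"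
    by (auto simp: cyc_def permutes_in_image[OF assms(2)] split: if_splits)
  then show ?thesis using inj assms(1) by (simp add: bij_betw_def endo_inj_surj)
qed

lemma restr_permutes:
  assumes "finite Q" "p permutes X" "p ` Q \<subseteq> Q"
  shows "restr Q p permutes Q"
proof (rule bij_imp_permutes)
  have "bij_betw p Q Q"
    using assms by (simp add: bij_betw_def endo_inj_surj permutes_inj_on[OF assms(2)])
  then show "bij_betw (restr Q p) Q Q"
    by (rule bij_betw_cong[THEN iffD1, rotated]) (simp add: restr_def)
qed (simp add: restr_def)

lemma restr_commute:
  assumes "commute p q" "p ` Q \<subseteq> Q" "q ` Q \<subseteq> Q"
  shows "commute (restr Q p) (restr Q q)"
  using assms(2,3) by (intro commuteI) (simp add: restr_def commuteD[OF assms(1)] image_subset_iff)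

section \<open>Tuples assembled from a block, a return map and a layering\<close>

context
  fixes X :: "'a set" and x0 :: 'a
  assumes finX: "finite X" and x0X: "x0 \<in> X"
begin

context
  fixes Q :: "'a set" and d l :: nat and qs c \<beta>
  assumes Q: "Q \<subseteq> X" "x0 \<in> Q" and d: "d \<ge> 1"
    and qs: "qs \<in> transitive_tuples l Q" and c: "c \<in> centralizer (set qs) Q"
    and \<beta>: "\<beta> \<in> blocks Q X d"
begin

private abbreviation "Y \<equiv> Q \<times> {..<d}"
private abbreviation "p \<equiv> transport \<beta> Y X (cyc c d)"
private abbreviation "lift q \<equiv> transport \<beta> Y X (map_prod q id)"

private lemma finQ: "finite Q" using Q finX finite_subset by blast

private lemma bij: "bij_betw \<beta> Y X" and \<beta>0: "x \<in> Q \<Longrightarrow> \<beta> (x, 0) = x"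
  using \<beta> by (auto simp: blocks_def)

private lemma qperm: "q \<in> set qs \<Longrightarrow> q permutes Q"
  using qs by (auto simp: transitive_tuples_def)

private lemma cperm: "c permutes Q"
  using c by (auto simp: centralizer_def)

private lemma lift_apply: "x \<in> Q \<Longrightarrow> i < d \<Longrightarrow> lift q (\<beta> (x, i)) = \<beta> (q x, i)"
  by (simp add: transport_apply[OF bij])

private lemma p_apply: "x \<in> Q \<Longrightarrow> i < d \<Longrightarrow> p (\<beta> (x, i)) = \<beta> (if Suc i < d then (x, Suc i) else (c x, 0))"
  by (simp add: transport_apply[OF bij] cyc_def)

text \<open>Transitivity of \<open>qs\<close> on Q spreads one point of Z over its whole layer. Then
  \<open>p\<close> climbs to the last layer, wraps around to layer 0, and climbs again through every
  layer.\<close>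

private lemma invariant_eq:
  assumes Z: "Z \<subseteq> X" "z \<in> Z" "\<And>q. q \<in> set qs \<Longrightarrow> lift q ` Z \<subseteq> Z" and pZ: "p ` Z \<subseteq> Z"
  shows "Z = X"
proof -
  have full: "\<beta> (y, i) \<in> Z" if "\<beta> (x, i) \<in> Z" "x \<in> Q" "y \<in> Q" "i < d" for x y i
  proof -
    have "{x \<in> Q. \<beta> (x, i) \<in> Z} = Q"
    proof (rule transitive_onD[of "set qs"])
      show "transitive_on (set qs) Q" using qs by (auto simp: transitive_tuples_def)
      show "x \<in> {x \<in> Q. \<beta> (x, i) \<in> Z}" using that by simp
      fix q y assume q: "q \<in> set qs" and y: "y \<in> {x \<in> Q. \<beta> (x, i) \<in> Z}"
      then show "q y \<in> {x \<in> Q. \<beta> (x, i) \<in> Z}"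
        using subsetD[OF Z(3)[OF q] imageI, of "\<beta> (y, i)"] lift_apply[of y i q] that(4)
          by (simp add: permutes_in_image[OF qperm[OF q]])
    qed auto
    then show ?thesis using that by blast
  qed
  have step: "\<beta> (x0, Suc i) \<in> Z" if "\<beta> (x0, i) \<in> Z" "Suc i < d" for i
    using that subsetD[OF pZ imageI, of "\<beta> (x0, i)"] p_apply[of x0 i] Q by simp
  have up: "\<beta> (x0, i + k) \<in> Z" if "\<beta> (x0, i) \<in> Z" "i + k < d" for i k
    using that by (induction k) (auto intro: step)
  obtain x i where xi: "x \<in> Q" "i < d" "z = \<beta> (x, i)"
    using bij Z by (auto simp: bij_betw_def)
  have "\<beta> (x0, i) \<in> Z" using full[of x i x0] xi Z(2) Q by auto
  then have "\<beta> (x0, d - 1) \<in> Z" using up[of i "d - 1 - i"] xi d by auto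
  then have "p (\<beta> (x0, d - 1)) \<in> Z" using pZ by blast
  then have "\<beta> (c x0, 0) \<in> Z" using p_apply[of x0 "d - 1"] Q d by simp
  then have "\<beta> (x0, 0) \<in> Z" using full[of "c x0" 0 x0] Q d by (simp add: permutes_in_image[OF cperm])
  then have "\<beta> (x, i) \<in> Z" if "x \<in> Q" "i < d" for x i
    using up[of 0 i] full[of x0 i x] that Q by simp
  then have "\<beta> ` Y \<subseteq> Z" by auto
  then show ?thesis using bij Z(1) by (auto simp: bij_betw_def)
qed

lemma induced_tuple_mem: "induced_tuple X Q d qs c \<beta> \<in> transitive_tuples (Suc l) X"
proof -
  have pc: "commute p (lift q)" if q: "q \<in> set qs" for q
  proof (rule transport_commute[OF bij])
    fix y assume y: "y \<in> Y"
    show "cyc c d y \<in> Y" "map_prod q id y \<in> Y"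
      using y by (auto simp: cyc_def permutes_in_image[OF qperm[OF q]] permutes_in_image[OF cperm])
    \<comment> \<open>Within the layers q and the climb act on different coordinates; only the wrap
      to layer 0 needs c to centralize \<open>qs\<close>.\<close>
    have qc: "commute q c" using c q by (simp add: centralizer_def)
    show "cyc c d (map_prod q id y) = map_prod q id (cyc c d y)"
      by (simp add: cyc_def split_beta commuteD[OF qc])
  qed
  have qc: "commute (lift q) (lift r)" if q: "q \<in> set qs" "r \<in> set qs" for q r
  proof (rule transport_commute[OF bij])
    fix y assume y: "y \<in> Y"
    show "map_prod q id y \<in> Y" "map_prod r id y \<in> Y"
      using y by (auto simp: permutes_in_image[OF qperm[OF q(1)]] permutes_in_image[OF qperm[OF q(2)]])
    have qr: "commute q r" using qs q by (simp add: transitive_tuples_def)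
    show "map_prod q id (map_prod r id y) = map_prod r id (map_prod q id y)"
      by (cases y) (simp add: commuteD[OF qr])
  qed
  have "bij_betw (map_prod q id) Y Y" if "q \<in> set qs" for q
    using permutes_imp_bij[OF qperm[OF that]] by (intro bij_betw_map_prod) auto
  then have "lift q permutes X" if "q \<in> set qs" for q
    using that by (intro transport_permutes[OF bij]) auto
  moreover have "p permutes X"
    by (intro transport_permutes[OF bij] bij_betw_cyc finQ cperm)
  moreover have "transitive_on (insert p (lift ` set qs)) X"
    unfolding transitive_on_def
  proof (intro allI impI)
    fix Z assume Z: "Z \<subseteq> X" "Z \<noteq> {}" "\<forall>q\<in>insert p (lift ` set qs). q ` Z \<subseteq> Z"
    then obtain z where "z \<in> Z" by blast
    then show "Z = X" using Z(1,3) by (intro invariant_eq) simp_all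
  qed
  moreover have "length qs = l" using qs by (simp add: transitive_tuples_def)
  ultimately show ?thesis
    using pc qc commute_sym[of "p"] by (simp add: transitive_tuples_def induced_tuple_def commute_refl)
qed

text \<open>Layer 0 is Q, so the lift of q extends q itself.\<close>

private lemma lift_Q: "x \<in> Q \<Longrightarrow> lift q x = q x" if "q \<in> set qs"
  using lift_apply[of x 0 q] \<beta>0[of x] \<beta>0[of "q x"] permutes_in_image[OF qperm[OF that], of x] d by simp

text \<open>Together with \<open>restr_induced_tuple\<close>, \<open>blocks_induced_tuple\<close>
  and \<open>return_induced_tuple\<close>, this recovers Q, \<open>qs\<close>, \<beta> and c from
  the tuple, so distinct data give distinct tuples.\<close>

lemma orb_induced_tuple: "orb (set (tl (induced_tuple X Q d qs c \<beta>))) x0 = Q"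
proof -
  have sub: "orb (lift ` set qs) x0 \<subseteq> Q"
    by (intro orb_subset) (auto simp: Q lift_Q permutes_in_image[OF qperm])
  have "orb (lift ` set qs) x0 = Q"
  proof (rule transitive_onD[of "set qs"])
    show "transitive_on (set qs) Q" using qs by (simp add: transitive_tuples_def)
    fix q x assume q: "q \<in> set qs" and x: "x \<in> orb (lift ` set qs) x0"
    then have "lift q x \<in> orb (lift ` set qs) x0" using orb.step[OF x, of "lift q"] by simp
    then show "q x \<in> orb (lift ` set qs) x0" using lift_Q[OF q, of x] sub x by auto
  qed (use sub orb.base in auto)
  then show ?thesis by (simp add: induced_tuple_def)
qed

lemma restr_induced_tuple: "map (restr Q) (tl (induced_tuple X Q d qs c \<beta>)) = qs"
proof -
  have "restr Q (lift q) = q" if "q \<in> set qs" for q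
    by (simp add: restr_def fun_eq_iff lift_Q[OF that] permutes_not_in[OF qperm[OF that]])
  then show ?thesis by (simp add: induced_tuple_def map_idI)
qed

private lemma funpow_p: "x \<in> Q \<Longrightarrow> i < d \<Longrightarrow> (p ^^ i) x = \<beta> (x, i)"
  by (induction i) (auto simp: \<beta>0 p_apply)

lemma blocks_induced_tuple:
  "restrict (\<lambda>(x, i). (hd (induced_tuple X Q d qs c \<beta>) ^^ i) x) (Q \<times> {..<d}) = \<beta>"
proof
  fix y :: "'a \<times> nat"
  obtain x i where y: "y = (x, i)" by (cases y)
  show "restrict (\<lambda>(x, i). (hd (induced_tuple X Q d qs c \<beta>) ^^ i) x) (Q \<times> {..<d}) y = \<beta> y"
  proof (cases "y \<in> Y")
    case True
    then show ?thesis using y funpow_p[of x i] by (simp add: induced_tuple_def)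
  next
    case False
    have "\<beta> \<in> Y \<rightarrow>\<^sub>E X" using \<beta> by (simp add: blocks_def)
    then have "\<beta> y = undefined" using False by (rule PiE_arb)
    then show ?thesis using False by (simp add: restrict_def)
  qed
qed

lemma return_induced_tuple: "restr Q (hd (induced_tuple X Q d qs c \<beta>) ^^ d) = c"
proof
  fix x
  have "(p ^^ d) x = c x" if x: "x \<in> Q"
  proof -
    obtain e where e: "d = Suc e" using d by (cases d) auto
    \<comment> \<open>The first d - 1 steps climb from layer 0 to the last layer; the remaining one
      wraps through c.\<close>
    have "(p ^^ d) x = p (\<beta> (x, e))" using funpow_p[OF x, of e] e by simp
    also have "\<dots> = c x" using p_apply[OF x, of e] e \<beta>0[of "c x"] x by (simp add: permutes_in_image[OF cperm])
    finally show ?thesis .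
  qed
  then show "restr Q (hd (induced_tuple X Q d qs c \<beta>) ^^ d) x = c x"
    by (simp add: restr_def induced_tuple_def permutes_not_in[OF cperm])
qed

end
end

lemma transitive_on_restr:
  "transitive_on (restr Q ` P) Q \<longleftrightarrow> transitive_on P Q"
proof -
  have "(restr Q q ` Z \<subseteq> Z) = (q ` Z \<subseteq> Z)" if "Z \<subseteq> Q" for q Z
  proof -
    have "restr Q q ` Z = q ` Z" using that by (intro image_cong) (auto simp: restr_def)
    then show ?thesis by simp
  qed
  then show ?thesis by (simp add: transitive_on_def ball_simps cong: imp_cong)
qed

section \<open>Block data read off a given tuple\<close>

context
  fixes X :: "'a set" and x0 :: 'a
  assumes finX: "finite X" and x0X: "x0 \<in> X"
begin

context
  fixes p :: "'a \<Rightarrow> 'a" and ps :: "('a \<Rightarrow> 'a) list" and l :: nat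
  assumes T: "p # ps \<in> transitive_tuples (Suc l) X"
begin

private definition "Q = orb (set ps) x0"
text \<open>The first return time of the base point to its tail orbit. It equals the number of tail
  orbits, \<open>card X div card Q\<close>, by \<open>e_eq\<close>.\<close>

private definition "e = (LEAST k. 0 < k \<and> (p ^^ k) x0 \<in> Q)"

private lemma perm: "p permutes X" "q \<in> set ps \<Longrightarrow> q permutes X"
  and comm: "q \<in> set ps \<Longrightarrow> commute p q"
  and comm': "q \<in> set ps \<Longrightarrow> r \<in> set ps \<Longrightarrow> commute q r"
  and tr: "transitive_on (insert p (set ps)) X"
  and len: "length ps = l"
  using T by (simp_all add: transitive_tuples_def)

private lemma powp_X: "(p ^^ k) x \<in> X \<longleftrightarrow> x \<in> X"
  by (rule permutes_in_image[OF permutes_funpow[OF perm(1)]])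

private lemma inj_powp: "(p ^^ k) x = (p ^^ k) y \<longleftrightarrow> x = y"
  by (rule inj_eq[OF permutes_inj[OF permutes_funpow[OF perm(1)]]])

private lemma QX: "Q \<subseteq> X"
  unfolding Q_def using x0X by (rule orb_subset[rotated]) (simp add: permutes_in_image[OF perm(2)])

private lemma x0Q: "x0 \<in> Q"
  unfolding Q_def by (rule orb.base)

private lemma finite_Q: "finite Q" using QX finX finite_subset by blast

private lemma q_Q: "q \<in> set ps \<Longrightarrow> x \<in> Q \<Longrightarrow> q x \<in> Q"
  unfolding Q_def by (rule orb.step)

private lemma powp_Q: "x \<in> Q \<Longrightarrow> (p ^^ k) ` Q = orb (set ps) ((p ^^ k) x)"
proof -
  assume x: "x \<in> Q"
  then have "Q = orb (set ps) x"
    using orb_eq[OF perm(2) finX x0X, of "set ps" x] by (simp add: Q_def)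
  then show ?thesis
    using orb_commute_image[of "set ps" "p ^^ k" x] commute_funpow[OF comm] by simp
qed

text \<open>The image of Q under a power of p is a tail orbit, and tail orbits are equal or
  disjoint; so an image that meets Q is Q.\<close>

private lemma powp_Q_eq: "x \<in> Q \<Longrightarrow> (p ^^ k) x \<in> Q \<Longrightarrow> (p ^^ k) ` Q = Q"
  using powp_Q[of x k] orb_eq[OF perm(2) finX x0X, of "set ps" "(p ^^ k) x"] by (simp add: Q_def)

private lemma e: "0 < e" "(p ^^ e) x0 \<in> Q" "\<And>k. 0 < k \<Longrightarrow> k < e \<Longrightarrow> (p ^^ k) x0 \<notin> Q"
proof -
  \<comment> \<open>Some return time exists because p has finite order.\<close>
  have "permutation p" using perm(1) finX permutation_permutes by blast
  then obtain n where "(p ^^ n) = id" "n > 0" by (rule permutation_is_nilpotent)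
  then have "0 < n \<and> (p ^^ n) x0 \<in> Q" using x0Q by simp
  then have "0 < e \<and> (p ^^ e) x0 \<in> Q" unfolding e_def by (rule LeastI)
  then show "0 < e" "(p ^^ e) x0 \<in> Q" by auto
  show "(p ^^ k) x0 \<notin> Q" if "0 < k" "k < e" for k
    using not_less_Least[of k "\<lambda>k. 0 < k \<and> (p ^^ k) x0 \<in> Q"] that unfolding e_def by blast
qed

private lemma powe_Q: "(p ^^ e) ` Q = Q"
  by (rule powp_Q_eq[OF x0Q e(2)])

text \<open>Injective: a coincidence between layers i < j would make the power j - i of p map Q onto
  itself, a return before time e. Onto: the union of the layers is invariant under the whole tuple,
  since the tail preserves each layer and the e-th image of Q is Q again; transitivity then makes it
  X.\<close>

private lemma powp_bij: "bij_betw (\<lambda>(x, i). (p ^^ i) x) (Q \<times> {..<e}) X"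
proof -
  have *: "x = y \<and> i = j" if "x \<in> Q" "y \<in> Q" "i \<le> j" "j < e" "(p ^^ i) x = (p ^^ j) y" for x y i j
  proof -
    have "(p ^^ j) y = (p ^^ i) ((p ^^ (j - i)) y)"
      using that(3) by (metis comp_apply funpow_add le_add_diff_inverse)
    then have x: "x = (p ^^ (j - i)) y" using that(5) by (simp add: inj_powp)
    then have "(p ^^ (j - i)) ` Q = Q" using that(1,2) by (intro powp_Q_eq[of y]) simp_all
    then have "(p ^^ (j - i)) x0 \<in> Q" using x0Q by blast
    then have "j - i = 0" using e(3)[of "j - i"] that(4) by linarith
    then show ?thesis using x that(3) by simp
  qed
  have "inj_on (\<lambda>(x, i). (p ^^ i) x) (Q \<times> {..<e})"
  proof (rule inj_onI)
    fix y z assume yz: "y \<in> Q \<times> {..<e}" "z \<in> Q \<times> {..<e}"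
      "(case y of (x, i) \<Rightarrow> (p ^^ i) x) = (case z of (x, i) \<Rightarrow> (p ^^ i) x)"
    obtain x i x' j where xs: "y = (x, i)" "z = (x', j)" by (cases y, cases z) blast
    show "y = z"
      using *[of x x' i j] *[of x' x j i] yz unfolding xs by (cases "i \<le> j") simp_all
  qed
  moreover have "(\<lambda>(x, i). (p ^^ i) x) ` (Q \<times> {..<e}) = X" (is "?Z = X")
  proof (rule transitive_onD[OF tr])
    show "?Z \<subseteq> X" using QX by (auto simp: powp_X)
    show "x0 \<in> ?Z" using x0Q e(1) by (intro image_eqI[of _ _ "(x0, 0)"]) auto
    fix q z assume q: "q \<in> insert p (set ps)" and "z \<in> ?Z"
    then obtain x i where xi: "x \<in> Q" "i < e" "z = (p ^^ i) x" by auto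
    consider "q \<in> set ps" | "q = p" "Suc i < e" | "q = p" "Suc i = e" using q xi(2) by force
    then show "q z \<in> ?Z"
    proof cases
      case 1
      have "q z = (p ^^ i) (q x)" using commuteD[OF commute_funpow[OF comm[OF 1]]] xi(3) by simp
      then show ?thesis using q_Q[OF 1 xi(1)] xi(2) by (intro image_eqI[of _ _ "(q x, i)"]) simp_all
    next
      case 2
      then show ?thesis using xi by (intro image_eqI[of _ _ "(x, Suc i)"]) simp_all
    next
      case 3
      then have "q z = (p ^^ e) x" using xi(3) by (metis comp_apply funpow.simps(2))
      moreover have "(p ^^ e) x \<in> Q" using powe_Q xi(1) by blast
      ultimately show ?thesis using e(1) by (intro image_eqI[of _ _ "((p ^^ e) x, 0)"]) simp_all
    qed
  qed
  ultimately show ?thesis by (simp add: bij_betw_def)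
qed

private lemma card_eq: "card X = card Q * e"
  using bij_betw_same_card[OF powp_bij] by (simp add: card_cartesian_product)

private lemma e_eq: "card X div card Q = e"
  using card_eq finite_Q x0Q by (auto simp: card_gt_0_iff)

lemma orb_block: "orb (set ps) x0 \<subseteq> X" "x0 \<in> orb (set ps) x0" "card (orb (set ps) x0) dvd card X"
  using QX x0Q card_eq by (simp_all add: Q_def)

context
  fixes qs c d and \<beta> :: "'a \<times> nat \<Rightarrow> 'a"
  assumes d: "d = card X div card (orb (set ps) x0)"
    and qs: "qs = map (restr (orb (set ps) x0)) ps"
    and c: "c = restr (orb (set ps) x0) (p ^^ d)"
    and \<beta>: "\<beta> = restrict (\<lambda>(x, i). (p ^^ i) x) (orb (set ps) x0 \<times> {..<d})"
begin

text \<open>The counting needs d as a quotient of cardinalities, the proofs here need it as a first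
  return time; \<open>e_eq\<close> reconciles the two.\<close>

private lemma eqs: "d = e" "qs = map (restr Q) ps" "c = restr Q (p ^^ e)"
    "\<beta> = restrict (\<lambda>(x, i). (p ^^ i) x) (Q \<times> {..<e})"
proof -
  show de: "d = e" using d e_eq by (simp add: Q_def)
  show "qs = map (restr Q) ps" "c = restr Q (p ^^ e)"
    "\<beta> = restrict (\<lambda>(x, i). (p ^^ i) x) (Q \<times> {..<e})"
    using qs c \<beta> by (simp_all add: Q_def flip: de)
qed

lemma restr_tuple_mem: "qs \<in> transitive_tuples l (orb (set ps) x0)"
proof -
  have sub: "q ` Q \<subseteq> Q" if "q \<in> set ps" for q using q_Q[OF that] by blast
  have "transitive_on (restr Q ` set ps) Q"
    unfolding transitive_on_restr Q_def using perm(2) finX x0X by (rule orb_transitive)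
  moreover have "restr Q q permutes Q" if "q \<in> set ps" for q
    by (rule restr_permutes[OF finite_Q perm(2)[OF that] sub[OF that]])
  moreover have "commute (restr Q q) (restr Q r)" if "q \<in> set ps" "r \<in> set ps" for q r
    by (rule restr_commute[OF comm'[OF that] sub[OF that(1)] sub[OF that(2)]])
  ultimately have "qs \<in> transitive_tuples l Q"
    using len by (simp add: transitive_tuples_def eqs(2))
  then show ?thesis by (simp add: Q_def)
qed

lemma restr_return_mem: "c \<in> centralizer (set qs) (orb (set ps) x0)"
proof -
  have sub: "q ` Q \<subseteq> Q" if "q \<in> set ps" for q using q_Q[OF that] by blast
  have "restr Q (p ^^ e) permutes Q"
    using powe_Q by (intro restr_permutes[OF finite_Q permutes_funpow[OF perm(1)]]) simp
  moreover have "commute (restr Q q) (restr Q (p ^^ e))" if "q \<in> set ps" for q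
    using powe_Q comm[OF that] sub[OF that]
    by (intro restr_commute) (simp_all add: commute_sym[of q] commute_funpow)
  ultimately have "c \<in> centralizer (set qs) Q" by (simp add: centralizer_def eqs)
  then show ?thesis by (simp add: Q_def)
qed

private lemma \<beta>_bij: "bij_betw \<beta> (Q \<times> {..<e}) X"
  using powp_bij unfolding eqs(4) by (subst bij_betw_restrict_eq)

lemma restr_blocks_mem: "\<beta> \<in> blocks (orb (set ps) x0) X d"
proof -
  have "\<beta> \<in> Q \<times> {..<e} \<rightarrow>\<^sub>E X"
    using bij_betw_imp_funcset[OF \<beta>_bij] by (simp add: eqs(4) PiE_def)
  moreover have "\<beta> (x, 0) = x" if "x \<in> Q" for x using that e(1) by (simp add: eqs(4))
  ultimately have "\<beta> \<in> blocks Q X e" using \<beta>_bij by (simp add: blocks_def)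
  then show ?thesis by (simp add: Q_def eqs(1))
qed

text \<open>Both sides are compared at the points \<open>(p ^^ i) x\<close> with x in Q, which
  exhaust X. Tail elements commute with \<open>p ^^ i\<close>; from the last layer p leads to
  \<open>(p ^^ e) x\<close>, which lies in Q and is c x in layer 0.\<close>

lemma induced_tuple_restr: "induced_tuple X (orb (set ps) x0) d qs c \<beta> = p # ps"
proof -
  have \<beta>_app: "\<beta> (x, i) = (p ^^ i) x" if "x \<in> Q" "i < e" for x i using that by (simp add: eqs(4))
  have "transport \<beta> (Q \<times> {..<e}) X (cyc c e) = p"
  proof (rule transport_eqI[OF \<beta>_bij perm(1)])
    fix y assume "y \<in> Q \<times> {..<e}"
    then obtain x i where xi: "y = (x, i)" "x \<in> Q" "i < e" by auto
    show "p (\<beta> y) = \<beta> (cyc c e y)"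
    proof (cases "Suc i < e")
      case True
      then show ?thesis using xi by (simp add: \<beta>_app cyc_def)
    next
      case False
      then have "e = Suc i" using xi(3) by simp
      moreover have "(p ^^ e) x \<in> Q" using powe_Q xi(2) by blast
      ultimately show ?thesis using xi by (simp add: \<beta>_app cyc_def eqs(3) restr_def)
    qed
  qed
  moreover have "transport \<beta> (Q \<times> {..<e}) X (map_prod (restr Q q) id) = q" if q: "q \<in> set ps" for q
  proof (rule transport_eqI[OF \<beta>_bij perm(2)[OF q]])
    fix y assume "y \<in> Q \<times> {..<e}"
    then obtain x i where xi: "y = (x, i)" "x \<in> Q" "i < e" by auto
    then show "q (\<beta> y) = \<beta> (map_prod (restr Q q) id y)"
      using commuteD[OF commute_funpow[OF comm[OF q]], of i x] q_Q[OF q xi(2)]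
      by (simp add: \<beta>_app restr_def)
  qed
  ultimately have "induced_tuple X Q e qs c \<beta> = p # ps"
    by (simp add: induced_tuple_def eqs(2) map_idI)
  then show ?thesis by (simp add: Q_def eqs(1))
qed

end
end
end

section \<open>Counting\<close>

lemma card_bijections:
  assumes "finite A" "finite B" "card A = card B"
  shows "card {f \<in> A \<rightarrow>\<^sub>E B. bij_betw f A B} = fact (card B)"
proof -
  have "bij_betw f A B \<longleftrightarrow> inj_on f A" if "f \<in> A \<rightarrow>\<^sub>E B" for f
  proof
    assume inj: "inj_on f A"
    have "f ` A = B"
      using that assms inj by (intro card_subset_eq) (auto simp: card_image)
    then show "bij_betw f A B" using inj by (simp add: bij_betw_def)
  qed (simp add: bij_betw_def)
  then have "{f \<in> A \<rightarrow>\<^sub>E B. bij_betw f A B} = {f \<in> A \<rightarrow>\<^sub>E B. inj_on f A}" by blast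
  then show ?thesis
    using card_inj_on_subset_funcset[OF assms(1,2), of A] assms(3) by (simp add: fact_prod_rev)
qed

text \<open>Layer 0 is forced, so \<beta> amounts to a bijection from the other d - 1 layers onto X
  - Q, two sets of the same size. The map \<open>ext\<close> puts layer 0 back.\<close>

lemma card_blocks:
  assumes X: "finite X" "Q \<subseteq> X" and card: "card X = card Q * d" and d: "1 \<le> d"
  shows "card (blocks Q X d) = fact (card X - card Q)"
proof -
  have finQ: "finite Q" using X finite_subset by blast
  let ?Y = "Q \<times> {..<d}" and ?Y' = "Q \<times> {1..<d}"
  let ?F = "{f \<in> ?Y' \<rightarrow>\<^sub>E (X - Q). bij_betw f ?Y' (X - Q)}"
  define ext where "ext f = (\<lambda>y\<in>?Y. if snd y = 0 then fst y else f y)" for f :: "'a \<times> nat \<Rightarrow> 'a"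
  have Y: "?Y = Q \<times> {0} \<union> ?Y'" using d by auto
  have "bij_betw (\<lambda>\<beta>. restrict \<beta> ?Y') (blocks Q X d) ?F"
  proof (rule bij_betw_byWitness[where f' = ext])
    show "\<forall>\<beta>\<in>blocks Q X d. ext (restrict \<beta> ?Y') = \<beta>"
    proof
      fix \<beta> assume \<beta>: "\<beta> \<in> blocks Q X d"
      then have ext: "\<beta> \<in> ?Y \<rightarrow>\<^sub>E X" and \<beta>0: "\<And>x. x \<in> Q \<Longrightarrow> \<beta> (x, 0) = x" by (simp_all add: blocks_def)
      show "ext (restrict \<beta> ?Y') = \<beta>"
      proof
        fix y :: "'a \<times> nat"
        show "ext (restrict \<beta> ?Y') y = \<beta> y"
          using PiE_arb[OF ext, of y] \<beta>0[of "fst y"]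
          by (cases y; cases "y \<in> ?Y") (auto simp: ext_def)
      qed
    qed
    show "\<forall>f\<in>?F. restrict (ext f) ?Y' = f"
    proof
      fix f assume "f \<in> ?F"
      then have f: "f \<in> ?Y' \<rightarrow>\<^sub>E (X - Q)" by simp
      show "restrict (ext f) ?Y' = f"
      proof
        fix y show "restrict (ext f) ?Y' y = f y"
          using PiE_arb[OF f, of y] by (cases y; cases "y \<in> ?Y'") (simp_all add: ext_def)
      qed
    qed
    show "(\<lambda>\<beta>. restrict \<beta> ?Y') ` blocks Q X d \<subseteq> ?F"
    proof (rule image_subsetI)
      fix \<beta> assume "\<beta> \<in> blocks Q X d"
      then have bij: "bij_betw \<beta> ?Y X" and \<beta>0: "\<And>x. x \<in> Q \<Longrightarrow> \<beta> (x, 0) = x" by (simp_all add: blocks_def)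
      have inj: "inj_on \<beta> ?Y" using bij by (rule bij_betw_imp_inj_on)
      have "\<beta> ` (Q \<times> {0}) = Q" using \<beta>0 by force
      moreover have "?Y' = ?Y - Q \<times> {0}" by auto
      ultimately have "\<beta> ` ?Y' = X - Q"
        using inj_on_image_set_diff[OF inj, of ?Y "Q \<times> {0}"] bij Y by (simp add: bij_betw_def)
      moreover have "inj_on \<beta> ?Y'" using inj by (rule inj_on_subset) (simp add: Y)
      ultimately have bij': "bij_betw \<beta> ?Y' (X - Q)" by (simp add: bij_betw_def)
      then have "bij_betw (restrict \<beta> ?Y') ?Y' (X - Q)" by (subst bij_betw_restrict_eq)
      moreover have "restrict \<beta> ?Y' \<in> ?Y' \<rightarrow>\<^sub>E (X - Q)"
        using bij_betw_imp_funcset[OF bij'] by (simp only: restrict_PiE_iff) blast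
      ultimately show "restrict \<beta> ?Y' \<in> ?F" by simp
    qed
    show "ext ` ?F \<subseteq> blocks Q X d"
    proof (rule image_subsetI)
      fix f assume "f \<in> ?F"
      then have bij: "bij_betw f ?Y' (X - Q)" by simp
      have "bij_betw (ext f) (Q \<times> {0} \<union> ?Y') (Q \<union> (X - Q))"
      proof (rule bij_betw_combine)
        show "bij_betw (ext f) (Q \<times> {0}) Q"
          using d by (intro bij_betw_byWitness[where f' = "\<lambda>x. (x, 0)"]) (auto simp: ext_def)
        show "bij_betw (ext f) ?Y' (X - Q)"
          by (rule bij_betw_cong[THEN iffD1, OF _ bij]) (auto simp: ext_def)
      qed auto
      then have b: "bij_betw (ext f) ?Y X" using X(2) by (simp add: Y Un_absorb1)
      then have "ext f \<in> ?Y \<rightarrow>\<^sub>E X"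
        using bij_betw_imp_funcset[OF b] by (simp add: PiE_def ext_def)
      then show "ext f \<in> blocks Q X d" using b d by (simp add: blocks_def ext_def)
    qed
  qed
  then have "card (blocks Q X d) = card ?F" by (rule bij_betw_same_card)
  also have "\<dots> = fact (card (X - Q))"
    using X finQ card by (intro card_bijections)
      (simp_all add: card_cartesian_product card_Diff_subset algebra_simps)
  finally show ?thesis using X finQ by (simp add: card_Diff_subset)
qed

lemma finite_transitive_tuples:
  assumes "finite X"
  shows "finite (transitive_tuples l X)"
proof (rule finite_subset)
  show "transitive_tuples l X \<subseteq> {ps. set ps \<subseteq> {p. p permutes X} \<and> length ps = l}"
    by (auto simp: transitive_tuples_def)
  show "finite {ps. set ps \<subseteq> {p. p permutes X} \<and> length ps = l}"
    using assms by (intro finite_lists_length_eq finite_permutations)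
qed

text \<open>The candidates for the tail orbit of the base point. Divisibility holds for every such
  orbit by \<open>orb_block\<close>, and it is what lets layers of size |Q| fill X exactly.\<close>

definition blocks_at :: "'a set \<Rightarrow> 'a \<Rightarrow> 'a set set" where
  "blocks_at X x0 = {Q. Q \<subseteq> X \<and> x0 \<in> Q \<and> card Q dvd card X}"

text \<open>Assembling (F) and reading off (G) are mutually inverse. For fixed Q, each
  \<open>qs\<close> admits |Q| return maps by \<open>card_centralizer\<close>, and the layerings
  contribute the factorial by \<open>card_blocks\<close>.\<close>

lemma card_transitive_tuples_Suc:
  assumes X: "finite X" and x0: "x0 \<in> X"
  shows "card (transitive_tuples (Suc l) X) =
    (\<Sum>Q\<in>blocks_at X x0. card (transitive_tuples l Q) * card Q * fact (card X - card Q))"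
proof -
  \<comment> \<open>The inner sum is dependent because the centralizer that contains c varies with
    \<open>qs\<close>; the layering is chosen independently of both.\<close>
  define D where "D = (SIGMA Q:blocks_at X x0.
    (SIGMA qs:transitive_tuples l Q. centralizer (set qs) Q) \<times> blocks Q X (card X div card Q))"
  define F where "F = (\<lambda>(Q, (qs, c), \<beta>). induced_tuple X Q (card X div card Q) qs c \<beta>)"
  define G where "G ps = (let Q = orb (set (tl ps)) x0; d = card X div card Q in
    (Q, (map (restr Q) (tl ps), restr Q (hd ps ^^ d)), restrict (\<lambda>(x, i). (hd ps ^^ i) x) (Q \<times> {..<d})))"
    for ps :: "('a \<Rightarrow> 'a) list"
  have blockD: "Q \<subseteq> X" "x0 \<in> Q" "1 \<le> card X div card Q" "card X = card Q * (card X div card Q)" "finite Q"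
    if "Q \<in> blocks_at X x0" for Q
  proof -
    show Q: "Q \<subseteq> X" "x0 \<in> Q" "card X = card Q * (card X div card Q)"
      using that by (simp_all add: blocks_at_def)
    show "finite Q" using Q(1) X finite_subset by blast
    have "card X \<noteq> 0" using X x0 by auto
    then show "1 \<le> card X div card Q" using Q(3) by (cases "card X div card Q") auto
  qed
  have "bij_betw F D (transitive_tuples (Suc l) X)"
  proof (rule bij_betw_byWitness[where f' = G])
    show "\<forall>t\<in>D. G (F t) = t"
    proof
      fix t assume "t \<in> D"
      then obtain Q qs c \<beta> where t: "t = (Q, (qs, c), \<beta>)" and Q: "Q \<in> blocks_at X x0"
        and m: "qs \<in> transitive_tuples l Q" "c \<in> centralizer (set qs) Q" "\<beta> \<in> blocks Q X (card X div card Q)"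
        by (auto simp: D_def)
      note hyps = X x0 blockD(1-3)[OF Q] m
      show "G (F t) = t"
        by (simp add: t F_def G_def Let_def orb_induced_tuple[OF hyps] restr_induced_tuple[OF hyps]
            blocks_induced_tuple[OF hyps] return_induced_tuple[OF hyps])
    qed
    show "F ` D \<subseteq> transitive_tuples (Suc l) X"
    proof (rule image_subsetI)
      fix t assume "t \<in> D"
      then obtain Q qs c \<beta> where t: "t = (Q, (qs, c), \<beta>)" and Q: "Q \<in> blocks_at X x0"
        and m: "qs \<in> transitive_tuples l Q" "c \<in> centralizer (set qs) Q" "\<beta> \<in> blocks Q X (card X div card Q)"
        by (auto simp: D_def)
      show "F t \<in> transitive_tuples (Suc l) X"
        using induced_tuple_mem[OF X x0 blockD(1-3)[OF Q] m] by (simp add: t F_def)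
    qed
    have ex: "\<exists>p ps. t = p # ps \<and> p # ps \<in> transitive_tuples (Suc l) X"
      if "t \<in> transitive_tuples (Suc l) X" for t :: "('a \<Rightarrow> 'a) list"
      using that by (cases t) (auto simp: transitive_tuples_def)
    show "\<forall>t\<in>transitive_tuples (Suc l) X. F (G t) = t"
    proof
      fix t assume "t \<in> transitive_tuples (Suc l) X"
      then obtain p ps where t: "t = p # ps" and T: "p # ps \<in> transitive_tuples (Suc l) X"
        using ex by blast
      show "F (G t) = t"
        unfolding t F_def G_def Let_def using induced_tuple_restr[OF X x0 T refl refl refl refl] by simp
    qed
    show "G ` transitive_tuples (Suc l) X \<subseteq> D"
    proof (rule image_subsetI)
      fix t assume "t \<in> transitive_tuples (Suc l) X"
      then obtain p ps where t: "t = p # ps" and T: "p # ps \<in> transitive_tuples (Suc l) X"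
        using ex by blast
      show "G t \<in> D"
        unfolding t D_def G_def Let_def
        using orb_block[OF X x0 T] restr_tuple_mem[OF X x0 T refl refl refl refl]
          restr_return_mem[OF X x0 T refl refl refl refl] restr_blocks_mem[OF X x0 T refl refl refl refl]
        by (simp add: blocks_at_def)
    qed
  qed
  then have "card (transitive_tuples (Suc l) X) = card D" by (rule bij_betw_same_card[symmetric])
  also have "\<dots> = (\<Sum>Q\<in>blocks_at X x0. card ((SIGMA qs:transitive_tuples l Q. centralizer (set qs) Q) \<times>
      blocks Q X (card X div card Q)))"
    unfolding D_def
  proof (rule card_SigmaI)
    show "finite (blocks_at X x0)"
      using X by (rule finite_subset[OF _ finite_Pow_iff[THEN iffD2], rotated]) (auto simp: blocks_at_def)
    show "\<forall>Q\<in>blocks_at X x0. finite ((SIGMA qs:transitive_tuples l Q. centralizer (set qs) Q) \<times>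
      blocks Q X (card X div card Q))"
    proof
      fix Q assume Q: "Q \<in> blocks_at X x0"
      have "finite (centralizer P Q)" for P
        using finite_permutations[OF blockD(5)[OF Q]] by (rule rev_finite_subset) (auto simp: centralizer_def)
      moreover have "finite (Q \<times> {..<card X div card Q} \<rightarrow>\<^sub>E X)"
        using X blockD(5)[OF Q] by (intro finite_PiE) auto
      then have "finite (blocks Q X (card X div card Q))"
        by (rule rev_finite_subset) (auto simp: blocks_def)
      ultimately show "finite ((SIGMA qs:transitive_tuples l Q. centralizer (set qs) Q) \<times>
          blocks Q X (card X div card Q))"
        using finite_transitive_tuples[OF blockD(5)[OF Q]] by (intro finite_cartesian_product finite_SigmaI)
    qed
  qed
  also have "\<dots> = (\<Sum>Q\<in>blocks_at X x0. card (transitive_tuples l Q) * card Q * fact (card X - card Q))"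
  proof (rule sum.cong[OF refl])
    fix Q assume Q: "Q \<in> blocks_at X x0"
    have "card (centralizer (set qs) Q) = card Q" if "qs \<in> transitive_tuples l Q" for qs
      using that by (intro card_centralizer[OF _ _ _ blockD(2)[OF Q]]) (simp_all add: transitive_tuples_def)
    moreover have "finite (centralizer P Q)" for P
      using finite_permutations[OF blockD(5)[OF Q]] by (rule rev_finite_subset) (auto simp: centralizer_def)
    ultimately have "card (SIGMA qs:transitive_tuples l Q. centralizer (set qs) Q) = card (transitive_tuples l Q) * card Q"
      using finite_transitive_tuples[OF blockD(5)[OF Q]] by (simp add: card_SigmaI)
    moreover have "card (blocks Q X (card X div card Q)) = fact (card X - card Q)"
      by (rule card_blocks[OF X blockD(1)[OF Q] blockD(4)[OF Q] blockD(3)[OF Q]])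
    ultimately show "card ((SIGMA qs:transitive_tuples l Q. centralizer (set qs) Q) \<times> blocks Q X (card X div card Q))
        = card (transitive_tuples l Q) * card Q * fact (card X - card Q)"
      by (simp add: card_cartesian_product)
  qed
  finally show ?thesis .
qed

lemma card_subsets_containing:
  assumes "finite X" "x0 \<in> X" "1 \<le> m"
  shows "card {Q. Q \<subseteq> X \<and> x0 \<in> Q \<and> card Q = m} = (card X - 1) choose (m - 1)"
proof -
  have "bij_betw (insert x0) {K. K \<subseteq> X - {x0} \<and> card K = m - 1} {Q. Q \<subseteq> X \<and> x0 \<in> Q \<and> card Q = m}"
  proof (rule bij_betw_byWitness[where f' = "\<lambda>Q. Q - {x0}"])
    show "insert x0 ` {K. K \<subseteq> X - {x0} \<and> card K = m - 1} \<subseteq> {Q. Q \<subseteq> X \<and> x0 \<in> Q \<and> card Q = m}"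
    proof (rule image_subsetI)
      fix K assume K: "K \<in> {K. K \<subseteq> X - {x0} \<and> card K = m - 1}"
      then have "finite K" "x0 \<notin> K" using assms(1) finite_subset[of K X] by auto
      then show "insert x0 K \<in> {Q. Q \<subseteq> X \<and> x0 \<in> Q \<and> card Q = m}" using K assms by auto
    qed
  qed (use assms in auto)
  then show ?thesis
    using n_subsets[of "X - {x0}" "m - 1"] assms by (simp add: bij_betw_same_card[symmetric])
qed

text \<open>This is the number of subgroups of index \<open>n\<close> in \<open>\<int>\<^sup>l\<close> (for \<open>n > 0\<close>).\<close>

primrec lattice_count :: "nat \<Rightarrow> nat \<Rightarrow> nat" where
  "lattice_count 0 n = (if n = 1 then 1 else 0)"
| "lattice_count (Suc l) n = (\<Sum>m | m dvd n. m * lattice_count l m)"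

text \<open>Grouping the blocks by size m gives (n - 1 choose m - 1) blocks with equal
  contributions. The factors (m - 1)! and (n - m)! turn this binomial coefficient into (n - 1)! for
  every m, which leaves the recursion of \<open>lattice_count\<close>.\<close>

lemma card_transitive_tuples:
  assumes "finite X" "X \<noteq> {}"
  shows "card (transitive_tuples l X) = fact (card X - 1) * lattice_count l (card X)"
  using assms
proof (induction l arbitrary: X)
  case 0
  \<comment> \<open>Under the empty tuple every subset is invariant, so only a one-point set is
    transitive.\<close>
  have "transitive_on {} X \<longleftrightarrow> card X = 1"
  proof
    assume "transitive_on {} X"
    then have "{x} = X" if "x \<in> X" for x using that by (intro transitive_onD[of "{}"]) auto
    then show "card X = 1" using 0(2) by (metis card_1_singleton_iff all_not_in_conv One_nat_def)
  next
    assume "card X = 1"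
    then obtain x where "X = {x}" by (auto simp: card_1_singleton_iff)
    then show "transitive_on {} X" by (auto simp: transitive_on_def)
  qed
  then have "transitive_tuples 0 X = (if card X = 1 then {[]} else {})"
    by (auto simp: transitive_tuples_def)
  then show ?case by simp
next
  case (Suc l)
  let ?n = "card X"
  obtain x0 where x0: "x0 \<in> X" using Suc.prems by blast
  have n: "?n > 0" using Suc.prems by (simp add: card_gt_0_iff)
  have fin: "finite (blocks_at X x0)"
    using Suc.prems(1) by (rule finite_subset[OF _ finite_Pow_iff[THEN iffD2], rotated]) (auto simp: blocks_at_def)
  have "card (transitive_tuples (Suc l) X) =
    (\<Sum>Q\<in>blocks_at X x0. card (transitive_tuples l Q) * card Q * fact (?n - card Q))"
    by (rule card_transitive_tuples_Suc[OF Suc.prems(1) x0])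
  also have "\<dots> = (\<Sum>Q\<in>blocks_at X x0. fact (card Q - 1) * lattice_count l (card Q) * card Q * fact (?n - card Q))"
  proof (rule sum.cong[OF refl])
    fix Q assume "Q \<in> blocks_at X x0"
    then have "finite Q" "Q \<noteq> {}" using Suc.prems(1) finite_subset by (auto simp: blocks_at_def)
    then show "card (transitive_tuples l Q) * card Q * fact (?n - card Q) =
        fact (card Q - 1) * lattice_count l (card Q) * card Q * fact (?n - card Q)"
      by (simp add: Suc.IH)
  qed
  also have "\<dots> = (\<Sum>m | m dvd ?n. \<Sum>Q | Q \<in> blocks_at X x0 \<and> card Q = m.
      fact (card Q - 1) * lattice_count l (card Q) * card Q * fact (?n - card Q))"
    by (rule sum.group[symmetric, OF fin]) (use n in \<open>auto simp: blocks_at_def\<close>)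
  also have "\<dots> = (\<Sum>m | m dvd ?n. fact (?n - 1) * (m * lattice_count l m))"
  proof (rule sum.cong[OF refl])
    fix m assume "m \<in> {m. m dvd ?n}"
    then have m: "m dvd ?n" "1 \<le> m" "m \<le> ?n" using n by (auto simp: dvd_imp_le intro: Nat.gr0I)
    have "(\<Sum>Q | Q \<in> blocks_at X x0 \<and> card Q = m.
        fact (card Q - 1) * lattice_count l (card Q) * card Q * fact (?n - card Q)) =
      (\<Sum>Q | Q \<subseteq> X \<and> x0 \<in> Q \<and> card Q = m. fact (m - 1) * lattice_count l m * m * fact (?n - m))"
      using m(1) by (intro sum.cong) (auto simp: blocks_at_def)
    also have "(\<Sum>Q | Q \<subseteq> X \<and> x0 \<in> Q \<and> card Q = m. fact (m - 1) * lattice_count l m * m * fact (?n - m)) =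
        (fact (m - 1) * fact ((?n - 1) - (m - 1)) * ((?n - 1) choose (m - 1))) * (m * lattice_count l m)"
      using m by (simp add: card_subsets_containing[OF Suc.prems(1) x0 m(2)] algebra_simps)
    also have "fact (m - 1) * fact ((?n - 1) - (m - 1)) * ((?n - 1) choose (m - 1)) = fact (?n - 1)"
      using m by (intro binomial_fact_lemma) simp
    finally show "(\<Sum>Q | Q \<in> blocks_at X x0 \<and> card Q = m.
        fact (card Q - 1) * lattice_count l (card Q) * card Q * fact (?n - card Q)) =
        fact (?n - 1) * (m * lattice_count l m)" .
  qed
  also have "\<dots> = fact (?n - 1) * lattice_count (Suc l) ?n" by (simp add: sum_distrib_left)
  finally show ?case .
qed

lemma B_comm_eq:
  assumes "1 \<le> n"
  shows "B_comm l n = real (lattice_count l n)"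
  using assms unfolding B_comm_def A_comm_eq_card[OF assms]
  by (subst card_transitive_tuples) simp_all

section \<open>The q-series\<close>

text \<open>The two products of length l share l - 1 factors. One has the extra first factor 1 - q^k
  z, the other the extra last factor 1 - q^(k+l) z, and these differ by q^k z (1 - q^l).\<close>

lemma q_pochhammer_telescope:
  assumes "1 \<le> l"
  shows "(1 - q ^ l) * (z * (q ^ k * q_pochhammer (q ^ (k + 1) * z) q (l - 1))) =
    q_pochhammer (q ^ Suc k * z) q l - q_pochhammer (q ^ k * z) q l"
proof -
  obtain r where r: "l = Suc r" using assms by (cases l) auto
  have "q_pochhammer (q ^ k * z) q (Suc r) = (1 - q ^ k * z) * q_pochhammer (q ^ Suc k * z) q r"
    by (simp add: q_pochhammer_def prod.lessThan_Suc_shift mult_ac del: prod.lessThan_Suc)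
  moreover have "q_pochhammer (q ^ Suc k * z) q (Suc r) =
      (1 - q ^ (k + Suc r) * z) * q_pochhammer (q ^ Suc k * z) q r"
    by (simp add: q_pochhammer_def power_add mult_ac)
  ultimately show ?thesis by (simp add: r power_add algebra_simps)
qed

lemma q_pochhammer_tendsto:
  assumes "norm q < 1"
  shows "(\<lambda>k. q_pochhammer (q ^ k * z) q l) \<longlonglongrightarrow> 1"
proof -
  have "(\<lambda>k. \<Prod>i<l. 1 - q ^ i * (q ^ k * z)) \<longlonglongrightarrow> (\<Prod>i<l. 1 - q ^ i * (0 * z))"
    using assms by (intro tendsto_intros LIMSEQ_power_zero)
  then show ?thesis by (simp add: q_pochhammer_def)
qed

lemma q_series_sums:
  assumes q: "norm q < 1" and l: "1 \<le> l" and z: "z \<noteq> 0"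
  shows "(\<lambda>k. q ^ k * q_pochhammer (q ^ (k + 1) * z) q (l - 1)) sums
    ((1 - q_pochhammer z q l) / ((1 - q ^ l) * z))"
proof -
  have "norm (q ^ l) < 1" using q l by (simp add: norm_power power_less_one_iff)
  then have ql: "1 - q ^ l \<noteq> 0" by auto
  have "(\<lambda>k. q_pochhammer (q ^ Suc k * z) q l - q_pochhammer (q ^ k * z) q l) sums
      (1 - q_pochhammer (q ^ 0 * z) q l)"
    by (rule telescope_sums[OF q_pochhammer_tendsto[OF q]])
  then have "(\<lambda>k. (1 - q ^ l) * (z * (q ^ k * q_pochhammer (q ^ (k + 1) * z) q (l - 1)))) sums
      (1 - q_pochhammer z q l)"
    by (simp only: q_pochhammer_telescope[OF l]) simp
  from sums_divide[OF this, of "(1 - q ^ l) * z"] show ?thesis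
    using ql z by (simp add: mult.assoc[symmetric])
qed

lemma q_series:
  assumes q: "norm q < 1" and l: "1 \<le> l"
  shows "summable (\<lambda>k. q ^ k * q_pochhammer (q ^ (k + 1) * z) q (l - 1))"
    and "z * (1 - q) * (\<Sum>k. q ^ k * q_pochhammer (q ^ (k + 1) * z) q (l - 1))
      = (1 - q) * (1 - q_pochhammer z q l) / (1 - q ^ l)"
proof -
  have "summable (\<lambda>k. q ^ k * q_pochhammer (q ^ (k + 1) * z) q (l - 1)) \<and>
    z * (1 - q) * (\<Sum>k. q ^ k * q_pochhammer (q ^ (k + 1) * z) q (l - 1))
      = (1 - q) * (1 - q_pochhammer z q l) / (1 - q ^ l)"
  proof (cases "z = 0")
    case True
    then show ?thesis using q by (simp add: q_pochhammer_def summable_geometric)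
  next
    case False
    note s = q_series_sums[OF q l False]
    show ?thesis
      using sums_summable[OF s] False unfolding sums_unique[OF s, symmetric] by simp
  qed
  then show "summable (\<lambda>k. q ^ k * q_pochhammer (q ^ (k + 1) * z) q (l - 1))"
    and "z * (1 - q) * (\<Sum>k. q ^ k * q_pochhammer (q ^ (k + 1) * z) q (l - 1))
      = (1 - q) * (1 - q_pochhammer z q l) / (1 - q ^ l)" by simp_all
qed

section \<open>Mean values\<close>

text \<open>Substitute n = d k: for d \<ge> 1 the condition d k \<le> N means k \<le> N div
  d.\<close>

lemma sum_divisor_convolution:
  fixes a g :: "nat \<Rightarrow> real"
  shows "(\<Sum>n = 1..N. \<Sum>d | d dvd n. g d * a (n div d)) = (\<Sum>d = 1..N. g d * (\<Sum>k = 1..N div d. a k))"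
proof -
  have "(\<Sum>n = 1..N. \<Sum>d | d dvd n. g d * a (n div d)) =
      (\<Sum>(n, d)\<in>(SIGMA n:{1..N}. {d. d dvd n}). g d * a (n div d))"
    by (rule sum.Sigma) auto
  also have "\<dots> = (\<Sum>(d, k)\<in>(SIGMA d:{1..N}. {1..N div d}). g d * a k)"
    by (rule sum.reindex_bij_witness[of _ "\<lambda>(d, k). (d * k, d)" "\<lambda>(n, d). (d, n div d)"])
      (auto simp: less_eq_div_iff_mult_less_eq div_le_mono mult.commute
        Suc_le_eq div_greater_zero_iff dvd_imp_le dvd_pos_nat dest: order_trans[OF dvd_imp_le])
  also have "\<dots> = (\<Sum>d = 1..N. \<Sum>k = 1..N div d. g d * a k)"
    by (rule sum.Sigma[symmetric]) auto
  finally show ?thesis by (simp add: sum_distrib_left)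
qed

lemma filterlim_div_const_nat_at_top:
  assumes "k > 0"
  shows "filterlim (\<lambda>N. N div k :: nat) at_top at_top"
  unfolding filterlim_at_top
proof
  fix Z
  show "eventually (\<lambda>N. Z \<le> N div k) at_top"
    using eventually_ge_at_top[of "Z * k"]
    by eventually_elim (use assms in \<open>simp add: less_eq_div_iff_mult_less_eq\<close>)
qed

lemma div_over_self_le:
  assumes "k > 0"
  shows "real (N div k) / real N \<le> 1 / real k"
proof -
  have "real (N div k) * real k \<le> real N" by (metis div_times_less_eq_dividend of_nat_le_iff of_nat_mult)
  then show ?thesis using assms by (cases "N = 0") (simp_all add: field_simps)
qed

lemma div_over_self_tendsto:
  assumes "k > 0"
  shows "(\<lambda>N. real (N div k) / real N) \<longlonglongrightarrow> 1 / real k"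
proof (rule tendsto_sandwich)
  show "eventually (\<lambda>N. 1 / real k - 1 / real N \<le> real (N div k) / real N) at_top"
    using eventually_gt_at_top[of 0]
  proof eventually_elim
    case (elim N)
    have "N < k * (N div k) + k" using assms by (metis add.commute dividend_less_times_div mult.commute mult_Suc_right)
    then have "real N \<le> real k * real (N div k) + real k"
      by (metis less_imp_le of_nat_add of_nat_le_iff of_nat_mult)
    then have "real N / real k - 1 \<le> real (N div k)" using assms by (simp add: field_simps)
    then have "(real N / real k - 1) / real N \<le> real (N div k) / real N" by (rule divide_right_mono) simp
    then show ?case using elim by (simp add: diff_divide_distrib)
  qed
  show "eventually (\<lambda>N. real (N div k) / real N \<le> 1 / real k) at_top"
    by (intro always_eventually allI div_over_self_le assms)
  have "(\<lambda>N. 1 / real k - 1 / real N) \<longlonglongrightarrow> 1 / real k - 0"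
    by (intro tendsto_intros lim_1_over_n)
  then show "(\<lambda>N. 1 / real k - 1 / real N) \<longlonglongrightarrow> 1 / real k" by simp
qed simp

text \<open>With A the mean of a, the left side is the sum over d of g(d) (N div d)/N A(N div d).
  Each term tends to g(d) M / d and is bounded by C |g(d)| / d, where C bounds A, so Tannery's
  theorem exchanges limit and sum.\<close>

lemma mean_value_convolution:
  fixes a g :: "nat \<Rightarrow> real"
  assumes a: "(\<lambda>N. 1 / real N * (\<Sum>n = 1..N. a n)) \<longlonglongrightarrow> M"
    and g: "summable (\<lambda>d. \<bar>g (Suc d)\<bar> / real (Suc d))"
  shows "(\<lambda>N. 1 / real N * (\<Sum>n = 1..N. \<Sum>d | d dvd n. g d * a (n div d)))
    \<longlonglongrightarrow> M * (\<Sum>d. g (Suc d) / real (Suc d))"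
proof -
  define A where "A = (\<lambda>N. 1 / real N * (\<Sum>n = 1..N. a n))"
  have A: "A \<longlonglongrightarrow> M" using a by (simp add: A_def)
  then have "Bseq A" by (intro convergent_imp_Bseq convergentI)
  then obtain C where C: "\<And>N. \<bar>A N\<bar> \<le> C" by (auto simp: Bseq_def)
  have C0: "0 \<le> C" using C[of 0] by linarith
  \<comment> \<open>The index is shifted: \<open>f d\<close> is the contribution of the divisor
    \<open>Suc d\<close>.\<close>
  define f where "f d N = g (Suc d) * (real (N div Suc d) / real N * A (N div Suc d))" for d N
  have "(\<lambda>N. suminf (\<lambda>d. f d N)) \<longlonglongrightarrow> (\<Sum>d. g (Suc d) * (1 / real (Suc d) * M))"
  proof (rule tannerys_theorem[THEN conjunct2, THEN conjunct2])
    show "f d \<longlonglongrightarrow> g (Suc d) * (1 / real (Suc d) * M)" for d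
      unfolding f_def
      by (intro tendsto_intros div_over_self_tendsto filterlim_compose[OF A]
          filterlim_div_const_nat_at_top) simp_all
    show "eventually (\<lambda>(d, N). norm (f d N) \<le> \<bar>g (Suc d)\<bar> / real (Suc d) * C) (at_top \<times>\<^sub>F at_top)"
    proof (intro always_eventually allI, clarify)
      fix d N :: nat
      have "real (N div Suc d) / real N \<le> 1 / real (Suc d)" by (rule div_over_self_le) simp
      then have "real (N div Suc d) / real N * \<bar>A (N div Suc d)\<bar> \<le> 1 / real (Suc d) * C"
        using C by (intro mult_mono) simp_all
      then have "\<bar>g (Suc d)\<bar> * (real (N div Suc d) / real N * \<bar>A (N div Suc d)\<bar>)
          \<le> \<bar>g (Suc d)\<bar> * (1 / real (Suc d) * C)"
        by (intro mult_left_mono) simp_all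
      then show "norm (f d N) \<le> \<bar>g (Suc d)\<bar> / real (Suc d) * C"
        by (simp add: f_def abs_mult)
    qed
    show "summable (\<lambda>d. \<bar>g (Suc d)\<bar> / real (Suc d) * C)" using g by (rule summable_mult2)
  qed simp
  moreover have "suminf (\<lambda>d. f d N) = 1 / real N * (\<Sum>n = 1..N. \<Sum>d | d dvd n. g d * a (n div d))" for N
  proof -
    \<comment> \<open>For d \<ge> N the quotient \<open>N div Suc d\<close> is 0, so the series is a
      finite sum.\<close>
    have "suminf (\<lambda>d. f d N) = (\<Sum>d<N. f d N)"
      by (rule suminf_finite) (auto simp: f_def)
    also have "\<dots> = (\<Sum>d<N. 1 / real N * (g (Suc d) * (\<Sum>k = 1..N div Suc d. a k)))"
      by (rule sum.cong) (auto simp: f_def A_def)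
    also have "\<dots> = 1 / real N * (\<Sum>d = 1..N. g d * (\<Sum>k = 1..N div d. a k))"
      by (simp add: sum_distrib_left sum.atLeast1_atMost_eq)
    finally show ?thesis by (simp only: sum_divisor_convolution)
  qed
  moreover have "(\<Sum>d. g (Suc d) * (1 / real (Suc d) * M)) = M * (\<Sum>d. g (Suc d) / real (Suc d))"
  proof -
    have "summable (\<lambda>d. g (Suc d) / real (Suc d))"
      using g by - (rule summable_rabs_cancel, simp)
    from suminf_mult[OF this, of M] show ?thesis by (simp add: mult_ac)
  qed
  ultimately show ?thesis by simp
qed

text \<open>Puts the recursion into convolution form: for n = m d, the factor m / n^(l+1) splits as
  d^(-(l+1)) times m^(-l).\<close>

lemma lattice_count_normalized_Suc:
  assumes "1 \<le> n"
  shows "real (lattice_count (Suc (Suc l)) n) / real n ^ Suc l =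
    (\<Sum>d | d dvd n. 1 / real d ^ Suc l * (real (lattice_count (Suc l) (n div d)) / real (n div d) ^ l))"
proof -
  have "real (lattice_count (Suc (Suc l)) n) / real n ^ Suc l =
      (\<Sum>m | m dvd n. real m * real (lattice_count (Suc l) m) / real n ^ Suc l)"
    by (simp only: lattice_count.simps(2)[of "Suc l"] of_nat_sum of_nat_mult sum_divide_distrib)
  also have "\<dots> = (\<Sum>d | d dvd n. 1 / real d ^ Suc l * (real (lattice_count (Suc l) (n div d)) / real (n div d) ^ l))"
  proof (rule sum.reindex_bij_witness[of _ "\<lambda>d. n div d" "\<lambda>d. n div d"])
    fix m assume "m \<in> {m. m dvd n}"
    then obtain d where n: "n = m * d" by auto
    then have md: "0 < m" "0 < d" using assms by (auto intro!: Nat.gr0I)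
    then show "1 / real (n div m) ^ Suc l * (real (lattice_count (Suc l) (n div (n div m))) / real (n div (n div m)) ^ l)
        = real m * real (lattice_count (Suc l) m) / real n ^ Suc l"
      by (simp add: n field_simps del: lattice_count.simps)
  qed (use assms in \<open>auto simp: div_dvd_iff_mult\<close>)
  finally show ?thesis .
qed

text \<open>Each induction step is one convolution with d^(-(l+1)), which contributes the sum of
  d^(-(l+2)), that is \<open>zeta\<close> at l + 2. The start is the count of subgroups of \<int>,
  exactly one of each index n \<ge> 1, with mean 1, the empty product.\<close>

lemma mean_lattice_count:
  "(\<lambda>N. 1 / real N * (\<Sum>n = 1..N. real (lattice_count (Suc l) n) / real n ^ l))
     \<longlonglongrightarrow> (\<Prod>j = 2..Suc l. zeta (real j))"
proof (induction l)
  case 0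
  have "lattice_count (Suc 0) n = 1" if "1 \<le> n" for n
  proof -
    have "lattice_count (Suc 0) n = (\<Sum>m | m dvd n. if m = 1 then 1 else 0)"
      by (simp only: lattice_count.simps) (rule sum.cong, auto)
    also have "\<dots> = 1" using that by (simp add: sum.delta)
    finally show ?thesis .
  qed
  then have "1 / real N * (\<Sum>n = 1..N. real (lattice_count (Suc 0) n) / real n ^ 0) = real N / real N" for N
    by (simp del: lattice_count.simps)
  \<comment> \<open>The quotient is 1 only for N > 0, as division by zero yields 0.\<close>
  moreover have "(\<lambda>N. real N / real N) \<longlonglongrightarrow> 1"
    by (rule tendsto_eventually) (use eventually_gt_at_top[of 0] in eventually_elim, simp)
  ultimately show ?case by simp
next
  case (Suc l)
  have eq: "1 / real (Suc d) ^ Suc l / real (Suc d) = 1 / real (Suc d) powr real (Suc (Suc l))" for d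
    by (simp add: powr_realpow del: of_nat_Suc)
  have "summable (\<lambda>d. inverse (real d ^ Suc (Suc l)))"
    by (rule inverse_power_summable) simp
  then have "summable (\<lambda>d. inverse (real (Suc d) ^ Suc (Suc l)))"
    by (subst (asm) summable_Suc_iff[symmetric])
  then have "summable (\<lambda>d. \<bar>1 / real (Suc d) ^ Suc l\<bar> / real (Suc d))"
    by (simp add: field_simps del: of_nat_Suc)
  from mean_value_convolution[OF Suc.IH this]
  have "(\<lambda>N. 1 / real N * (\<Sum>n = 1..N. \<Sum>d | d dvd n.
        1 / real d ^ Suc l * (real (lattice_count (Suc l) (n div d)) / real (n div d) ^ l)))
      \<longlonglongrightarrow> (\<Prod>j = 2..Suc l. zeta (real j)) * zeta (real (Suc (Suc l)))"
    by (simp only: eq zeta_def)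
  moreover have "(\<Sum>n = 1..N. real (lattice_count (Suc (Suc l)) n) / real n ^ Suc l) =
     (\<Sum>n = 1..N. \<Sum>d | d dvd n.
        1 / real d ^ Suc l * (real (lattice_count (Suc l) (n div d)) / real (n div d) ^ l))" for N
    by (rule sum.cong[OF refl], rule lattice_count_normalized_Suc) simp
  moreover have "(\<Prod>j = 2..Suc (Suc l). zeta (real j)) = (\<Prod>j = 2..Suc l. zeta (real j)) * zeta (real (Suc (Suc l)))"
    by (simp add: prod.cl_ivl_Suc mult.commute)
  ultimately show ?case by (simp only:)
qed

theorem theorem1:
  fixes l :: nat
  assumes "2 \<le> l"
  shows
    "(\<forall>q z :: complex. norm q < 1 \<longrightarrow>
        summable (\<lambda>k. q ^ k * q_pochhammer (q ^ (k + 1) * z) q (l - 1)) \<and>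
        z * (1 - q) * (\<Sum>k. q ^ k * q_pochhammer (q ^ (k + 1) * z) q (l - 1))
          = (1 - q) * (1 - q_pochhammer z q l) / (1 - q ^ l)) \<and>
     (\<lambda>N. 1 / real N * (\<Sum>n = 1..N. B_comm l n / real n ^ (l - 1)))
        \<longlonglongrightarrow> (\<Prod>j = 2..l. zeta (real j))"
proof (intro conjI allI impI)
  fix q z :: complex
  assume q: "norm q < 1"
  have l: "1 \<le> l" using assms by simp
  show "summable (\<lambda>k. q ^ k * q_pochhammer (q ^ (k + 1) * z) q (l - 1))"
    and "z * (1 - q) * (\<Sum>k. q ^ k * q_pochhammer (q ^ (k + 1) * z) q (l - 1))
      = (1 - q) * (1 - q_pochhammer z q l) / (1 - q ^ l)"
    using q_series[OF q l] by blast+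
next
  obtain m where m: "l = Suc m" using assms by (cases l) auto
  have "(\<Sum>n = 1..N. B_comm l n / real n ^ (l - 1)) =
      (\<Sum>n = 1..N. real (lattice_count (Suc m) n) / real n ^ m)" for N
    by (rule sum.cong) (simp_all add: B_comm_eq m del: lattice_count.simps)
  then show "(\<lambda>N. 1 / real N * (\<Sum>n = 1..N. B_comm l n / real n ^ (l - 1)))
      \<longlonglongrightarrow> (\<Prod>j = 2..l. zeta (real j))"
    using mean_lattice_count[of m] by (simp only: m)
qed

end
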